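(* Let $\mathcal{H}$ be a separable complex Hilbert space with an orthogonal decomposition $\mathcal{H}=\mathcal{H}_1\oplus\mathcal{H}_0\oplus\mathcal{H}_{-1}$. Let $S\in\mathcal{L}(\mathcal{H}_1)$ be an isometry, $N\in\mathcal{L}(\mathcal{H}_0)$ a nilpotent operator of order $n$ and $C\in\mathcal{L}(\mathcal{H}_{-1})$ a co-isometry. Then the characteristic function of any contraction on $\mathcal{H}$ of the form $$T=\begin{bmatrix}S&*&*\\0&N&*\\0&0&C\end{bmatrix}$$ is a polynomial of degree $\le n$.
   Context: The order of a nilpotent operator $N$ is the smallest power $p$ for which $N^p=0$. For a contraction $T$ put $D_T=(I-T^*T)^{1/2}$, $D_{T^*}=(I-TT^* )^{1/2}$, $\mathcal{D}_T=\overline{\mathrm{Ran}\,D_T}$, $\mathcal{D}_{T^*}=\overline{\mathrm{Ran}\,D_{T^*}}$. The characteristic function of $T$ is the $\mathcal{L}(\mathcal{D}_T,\mathcal{D}_{T^*})$-valued analytic function $\Theta_T(z)=[-T+zD_{T^*}(I-zT^* )^{-1}D_T]|_{\mathcal{D}_T}$, $z\in\mathbb{D}$. Entries $*$ are unspecified bounded operators. *)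

theory Defs
  imports "HOL-Analysis.Analysis"
begin

text \<open>
  Complex inner product spaces are built on top of the real ones: the real scalar
  multiplication, the inner product \<open>(\<bullet>)\<close>, the norm and the topology of the library are
  those induced by the complex structure. The inner product \<open>cinner\<close> is linear in its
  first argument.
\<close>

class complex_inner = real_inner +
  fixes scaleC :: "complex \<Rightarrow> 'a \<Rightarrow> 'a"  (infixr "*\<^sub>C" 75)
    and cinner :: "'a \<Rightarrow> 'a \<Rightarrow> complex"
  assumes scaleC_add_right: "c *\<^sub>C (x + y) = c *\<^sub>C x + c *\<^sub>C y"
    and scaleC_add_left: "(c + d) *\<^sub>C x = c *\<^sub>C x + d *\<^sub>C x"
    and scaleC_scaleC: "c *\<^sub>C d *\<^sub>C x = (c * d) *\<^sub>C x"
    and scaleR_scaleC: "r *\<^sub>R x = complex_of_real r *\<^sub>C x"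
    and cinner_commute: "cinner x y = cnj (cinner y x)"
    and cinner_add_left: "cinner (x + y) w = cinner x w + cinner y w"
    and cinner_scaleC_left: "cinner (c *\<^sub>C x) y = c * cinner x y"
    and inner_eq_Re_cinner: "x \<bullet> y = Re (cinner x y)"

class chilbert_space = complex_inner + complete_space

instantiation complex :: chilbert_space
begin

definition scaleC_complex :: "complex \<Rightarrow> complex \<Rightarrow> complex"
  where "scaleC_complex c x = c * x"

definition cinner_complex :: "complex \<Rightarrow> complex \<Rightarrow> complex"
  where "cinner_complex x y = x * cnj y"

instance
  by standard
    (auto simp: scaleC_complex_def cinner_complex_def inner_complex_def
      scaleR_conv_of_real algebra_simps)

end

definition closed_csubspace :: "'a::complex_inner set \<Rightarrow> bool"
  where "closed_csubspace M \<longleftrightarrow> subspace M \<and> (\<forall>c. \<forall>x\<in>M. c *\<^sub>C x \<in> M) \<and> closed M"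

definition orthogonal_decomposition ::
    "'a::complex_inner set \<Rightarrow> 'a set \<Rightarrow> 'a set \<Rightarrow> bool"
  where "orthogonal_decomposition H1 H0 Hm \<longleftrightarrow>
    closed_csubspace H1 \<and> closed_csubspace H0 \<and> closed_csubspace Hm \<and>
    (\<forall>x\<in>H1. \<forall>y\<in>H0. cinner x y = 0) \<and>
    (\<forall>x\<in>H1. \<forall>y\<in>Hm. cinner x y = 0) \<and>
    (\<forall>x\<in>H0. \<forall>y\<in>Hm. cinner x y = 0) \<and>
    (\<forall>h. \<exists>x\<in>H1. \<exists>y\<in>H0. \<exists>z\<in>Hm. h = x + y + z)"

text \<open>
  \<open>bounded_ops M K\<close> is \<open>\<L>(M, K)\<close> for complex subspaces \<open>M\<close> and \<open>K\<close>. Operators are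
  represented by total functions whose values outside \<open>M\<close> are irrelevant.
\<close>

definition bounded_ops :: "'a::complex_inner set \<Rightarrow> 'b::complex_inner set \<Rightarrow> ('a \<Rightarrow> 'b) set"
  where "bounded_ops M K = {f.
    (\<forall>x\<in>M. f x \<in> K) \<and>
    (\<forall>x\<in>M. \<forall>y\<in>M. f (x + y) = f x + f y) \<and>
    (\<forall>c. \<forall>x\<in>M. f (c *\<^sub>C x) = c *\<^sub>C f x) \<and>
    (\<exists>b. \<forall>x\<in>M. norm (f x) \<le> b * norm x)}"

text \<open>
  The adjoint is unique on \<open>K\<close>; its values outside \<open>K\<close> are unspecified, hence the use of
  \<open>SOME\<close>.
\<close>

definition adjoint_on ::
    "'a::complex_inner set \<Rightarrow> 'b::complex_inner set \<Rightarrow> ('a \<Rightarrow> 'b) \<Rightarrow> 'b \<Rightarrow> 'a"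
  where "adjoint_on M K f =
    (SOME g. g \<in> bounded_ops K M \<and> (\<forall>x\<in>M. \<forall>y\<in>K. cinner (f x) y = cinner x (g y)))"

abbreviation cadjoint :: "('a::complex_inner \<Rightarrow> 'a) \<Rightarrow> 'a \<Rightarrow> 'a"
  where "cadjoint \<equiv> adjoint_on UNIV UNIV"

definition isometry_on :: "'a::complex_inner set \<Rightarrow> ('a \<Rightarrow> 'a) \<Rightarrow> bool"
  where "isometry_on M S \<longleftrightarrow> S \<in> bounded_ops M M \<and> (\<forall>x\<in>M. norm (S x) = norm x)"

definition coisometry_on :: "'a::complex_inner set \<Rightarrow> ('a \<Rightarrow> 'a) \<Rightarrow> bool"
  where "coisometry_on M C \<longleftrightarrow> C \<in> bounded_ops M M \<and> isometry_on M (adjoint_on M M C)"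

text \<open>The order \<open>0\<close> occurs exactly when \<open>M\<close> is the zero space.\<close>

definition nilpotent_on :: "'a::complex_inner set \<Rightarrow> ('a \<Rightarrow> 'a) \<Rightarrow> nat \<Rightarrow> bool"
  where "nilpotent_on M N n \<longleftrightarrow>
    N \<in> bounded_ops M M \<and> (\<forall>x\<in>M. (N ^^ n) x = 0) \<and> (\<forall>p<n. \<exists>x\<in>M. (N ^^ p) x \<noteq> 0)"

definition contraction :: "('a::complex_inner \<Rightarrow> 'a) \<Rightarrow> bool"
  where "contraction T \<longleftrightarrow> T \<in> bounded_ops UNIV UNIV \<and> (\<forall>x. norm (T x) \<le> norm x)"

text \<open>The action of the operator matrix with rows \<open>(S, A, B)\<close>, \<open>(0, N, D)\<close>, \<open>(0, 0, C)\<close>.\<close>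

definition upper_triangular_form ::
    "'a::complex_inner set \<Rightarrow> 'a set \<Rightarrow> 'a set \<Rightarrow>
     ('a \<Rightarrow> 'a) \<Rightarrow> ('a \<Rightarrow> 'a) \<Rightarrow> ('a \<Rightarrow> 'a) \<Rightarrow> ('a \<Rightarrow> 'a) \<Rightarrow> bool"
  where "upper_triangular_form H1 H0 Hm S N C T \<longleftrightarrow>
    (\<exists>A\<in>bounded_ops H0 H1. \<exists>B\<in>bounded_ops Hm H1. \<exists>D\<in>bounded_ops Hm H0.
      \<forall>x\<in>H1. \<forall>y\<in>H0. \<forall>z\<in>Hm.
        T (x + y + z) = (S x + A y + B z) + (N y + D z) + C z)"

definition positive_op :: "('a::complex_inner \<Rightarrow> 'a) \<Rightarrow> bool"
  where "positive_op A \<longleftrightarrow> A \<in> bounded_ops UNIV UNIV \<and>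
    (\<forall>x. cinner (A x) x \<in> \<real> \<and> 0 \<le> Re (cinner (A x) x))"

definition sqrt_op :: "('a::complex_inner \<Rightarrow> 'a) \<Rightarrow> 'a \<Rightarrow> 'a"
  where "sqrt_op A = (THE B. positive_op B \<and> B \<circ> B = A)"

definition defect_op :: "('a::complex_inner \<Rightarrow> 'a) \<Rightarrow> 'a \<Rightarrow> 'a"
  where "defect_op T = sqrt_op (\<lambda>x. x - cadjoint T (T x))"

definition defect_op_adj :: "('a::complex_inner \<Rightarrow> 'a) \<Rightarrow> 'a \<Rightarrow> 'a"
  where "defect_op_adj T = sqrt_op (\<lambda>x. x - T (cadjoint T x))"

definition defect_space :: "('a::complex_inner \<Rightarrow> 'a) \<Rightarrow> 'a set"
  where "defect_space T = closure (range (defect_op T))"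

definition defect_space_adj :: "('a::complex_inner \<Rightarrow> 'a) \<Rightarrow> 'a set"
  where "defect_space_adj T = closure (range (defect_op_adj T))"

text \<open>
  For a contraction \<open>T\<close> and \<open>cmod z < 1\<close> the operator \<open>I - zT\<^sup>*\<close> is a bijection of the
  space, so \<open>inv\<close> is its inverse.
\<close>

definition characteristic_function ::
    "('a::complex_inner \<Rightarrow> 'a) \<Rightarrow> complex \<Rightarrow> 'a \<Rightarrow> 'a"
  where "characteristic_function T z =
    (\<lambda>x\<in>defect_space T.
      - T x + z *\<^sub>C defect_op_adj T (inv (\<lambda>h. h - z *\<^sub>C cadjoint T h) (defect_op T x)))"

text \<open>
  \<open>F\<close>, a function on the open unit disc with values in \<open>\<L>(M, K)\<close>, is a polynomial of
  degree at most \<open>n\<close> with coefficients in \<open>\<L>(M, K)\<close>.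
\<close>

definition op_polynomial_le ::
    "'a::complex_inner set \<Rightarrow> 'b::complex_inner set \<Rightarrow> nat \<Rightarrow> (complex \<Rightarrow> 'a \<Rightarrow> 'b) \<Rightarrow> bool"
  where "op_polynomial_le M K n F \<longleftrightarrow>
    (\<exists>A. (\<forall>k\<le>n. A k \<in> bounded_ops M K) \<and>
      (\<forall>z\<in>ball 0 1. \<forall>x\<in>M. F z x = (\<Sum>k\<le>n. z ^ k *\<^sub>C A k x)))"

end

theory Submission
  imports Defs
begin

text \<open>
  Write \<open>V\<close> for the adjoint of \<open>T\<close> and \<open>D\<close>, \<open>E\<close> for the defect operators of \<open>T\<close> and \<open>V\<close>. In the
  disc the Neumann series turns the characteristic function into the power series with constant
  term \<open>- T\<close> and with \<open>E V\<^sup>k D\<close> as coefficient of \<open>z\<^sup>k\<^sup>+\<^sup>1\<close>, so the claim is that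
  \<open>E V\<^sup>k D = 0\<close> for \<open>k \<ge> n\<close>. Since \<open>\<parallel>D x\<parallel>\<^sup>2 = \<parallel>x\<parallel>\<^sup>2 - \<parallel>T x\<parallel>\<^sup>2\<close>, the operator \<open>D\<close> kills
  \<open>H1\<close>, where \<open>T\<close> is the isometry \<open>S\<close>; being symmetric, it has its range in the complement of \<open>H1\<close>
  (\<open>defect_op_H1_perp\<close>). Dually \<open>V\<close> restricts to \<open>Hm\<close> as the adjoint of \<open>C\<close>, which is isometric,
  so \<open>E\<close> kills \<open>Hm\<close> (\<open>defect_op_adj_Hm\<close>). Between the two, \<open>V\<close> is lower triangular with the adjoint
  of \<open>N\<close> as its middle entry, so \<open>V\<^sup>n\<close> maps the complement of \<open>H1\<close> into \<open>Hm\<close>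
  (\<open>funpow_cadjoint_H1_perp\<close>). Instead of summing the infinite series it is enough to iterate the
  equation \<open>h = u + z V h\<close> exactly \<open>n\<close> times: the remainder \<open>z\<^sup>n V\<^sup>n h\<close> lies in \<open>Hm\<close>, provided
  that \<open>h\<close> is orthogonal to \<open>H1\<close>, and this holds because the equation can be solved inside that
  invariant closed subspace (\<open>defect_op_adj_resolvent\<close>).

  The coefficients must also map the defect space of \<open>T\<close> into that of \<open>V\<close>. For \<open>E V\<^sup>k D\<close> this is
  clear. For \<open>T\<close>, the defect spaces are the orthogonal complements of the kernels of \<open>D\<close> and \<open>E\<close>,
  and \<open>V\<close> maps the kernel of \<open>E\<close> into that of \<open>D\<close>; the intertwining relation between \<open>T\<close> and the
  square roots is thereby avoided.

  What remains is the existence of the objects involved. Adjoints come from the Riesz representation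
  theorem. The square root of \<open>I - B\<close>, for a symmetric contraction \<open>B\<close>, is the
  binomial series of \<open>(1 - t)\<^sup>1\<^sup>/\<^sup>2\<close> at \<open>B\<close>. That series converges absolutely even at \<open>t = 1\<close>, and
  all its coefficients after the first are nonpositive with total at least \<open>- 1\<close>, which gives both
  convergence and positivity. Its sum commutes with everything that commutes with \<open>B\<close>, which gives
  complex linearity and uniqueness. These two parts are carried out for the real inner product,
  since scalar multiplication by a complex number is just another bounded operator.
\<close>

section \<open>Orthogonal projections and adjoints in real Hilbert spaces\<close>

lemma linear_coeff_zero_of_quadratic_nonneg:
  fixes a b :: real
  assumes "\<And>t. 0 \<le> t * a + t\<^sup>2 * b"
  shows "a = 0"
proof (rule ccontr)
  assume a: "a \<noteq> 0"
  \<comment> \<open>At \<open>t = - a / c\<close> the linear term dominates as soon as \<open>c\<close> exceeds \<open>b\<close>.\<close>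
  define c where "c = \<bar>b\<bar> + 1"
  have c: "c > 0" "b < c"
    by (auto simp: c_def)
  have "0 \<le> (- a / c) * a + (- a / c)\<^sup>2 * b"
    by (rule assms)
  also have "\<dots> = (a\<^sup>2 / c\<^sup>2) * (b - c)"
    using c by (simp add: field_simps power2_eq_square)
  also have "\<dots> < 0"
    using a c by (intro mult_pos_neg) auto
  finally show False
    by simp
qed

text \<open>
  A minimizing sequence for the distance to \<open>M\<close> is Cauchy by the parallelogram law; its limit
  \<open>p\<close> minimizes the distance, and the first variation of \<open>\<parallel>v - p + t m\<parallel>\<^sup>2\<close> at \<open>t = 0\<close> vanishes.
\<close>

lemma projection_exists:
  fixes M :: "'a::{real_inner, banach} set"
  assumes M: "subspace M" "closed M"
  shows "\<exists>p\<in>M. \<forall>m\<in>M. (v - p) \<bullet> m = 0"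
proof -
  define d where "d = (INF m\<in>M. (norm (v - m))\<^sup>2)"
  have bdd: "bdd_below ((\<lambda>m. (norm (v - m))\<^sup>2) ` M)"
    by (rule bdd_belowI[of _ 0]) auto
  have dle: "d \<le> (norm (v - m))\<^sup>2" if "m \<in> M" for m
    unfolding d_def using bdd that by (rule cINF_lower)
  have ne: "M \<noteq> {}"
    using M subspace_0 by auto
  have "\<exists>m\<in>M. (norm (v - m))\<^sup>2 < d + 1 / Suc k" for k
  proof (rule ccontr)
    assume "\<not> ?thesis"
    then have "d + 1 / Suc k \<le> d"
      unfolding d_def by (intro cINF_greatest) (use ne in \<open>auto simp: not_less\<close>)
    moreover have "0 < 1 / real (Suc k)" by simp
    ultimately show False by linarith
  qed
  then obtain p where p: "\<And>k. p k \<in> M" "\<And>k. (norm (v - p k))\<^sup>2 < d + 1 / Suc k"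
    by metis
  \<comment> \<open>The parallelogram law, with the midpoint of \<open>p i\<close> and \<open>p j\<close> at distance at least
    \<open>sqrt d\<close> from \<open>v\<close>.\<close>
  have close: "(norm (p i - p j))\<^sup>2 \<le> 2 / Suc i + 2 / Suc j" for i j
  proof -
    have "(1/2) *\<^sub>R (p i + p j) \<in> M"
      using M p by (simp add: subspace_add subspace_scale)
    then have "d \<le> (norm (v - (1/2) *\<^sub>R (p i + p j)))\<^sup>2"
      by (rule dle)
    moreover have "(norm (p i - p j))\<^sup>2 + 4 * (norm (v - (1/2) *\<^sub>R (p i + p j)))\<^sup>2
        = 2 * (norm (v - p i))\<^sup>2 + 2 * (norm (v - p j))\<^sup>2"
      by (simp add: power2_norm_eq_inner inner_diff_left inner_diff_right inner_add_left
          inner_add_right inner_commute algebra_simps)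
    ultimately show ?thesis
      using p(2)[of i] p(2)[of j] by simp
  qed
  have "Cauchy p"
  proof (rule metric_CauchyI)
    fix e :: real assume e: "0 < e"
    obtain N :: nat where N: "inverse (real (Suc N)) < e\<^sup>2 / 4"
      using reals_Archimedean[of "e\<^sup>2 / 4"] e by auto
    have small: "1 / Suc i < e\<^sup>2 / 4" if "i \<ge> N" for i
    proof -
      have "1 / real (Suc i) \<le> 1 / real (Suc N)"
        using that by (intro divide_left_mono) auto
      then show ?thesis
        using N by (simp add: inverse_eq_divide)
    qed
    have "dist (p i) (p j) < e" if "i \<ge> N" "j \<ge> N" for i j
    proof -
      have "(norm (p i - p j))\<^sup>2 < e\<^sup>2"
        using close[of i j] small[OF that(1)] small[OF that(2)] by simp
      then show ?thesis
        using e by (simp add: dist_norm power2_less_imp_less)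
    qed
    then show "\<exists>N. \<forall>i\<ge>N. \<forall>j\<ge>N. dist (p i) (p j) < e"
      by blast
  qed
  then obtain q where q: "p \<longlonglongrightarrow> q"
    using Cauchy_convergent convergent_def by blast
  have qM: "q \<in> M"
    using M(2) p(1) q closed_sequentially by blast
  have "(norm (v - q))\<^sup>2 \<le> d"
  proof (rule LIMSEQ_le)
    show "(\<lambda>k. (norm (v - p k))\<^sup>2) \<longlonglongrightarrow> (norm (v - q))\<^sup>2"
      by (intro tendsto_intros q)
    have "(\<lambda>k. d + 1 / real (Suc k)) \<longlonglongrightarrow> d + 0"
      using LIMSEQ_inverse_real_of_nat by (intro tendsto_intros) (simp add: inverse_eq_divide)
    then show "(\<lambda>k. d + 1 / real (Suc k)) \<longlonglongrightarrow> d"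
      by simp
    show "\<exists>N. \<forall>k\<ge>N. (norm (v - p k))\<^sup>2 \<le> d + 1 / real (Suc k)"
      using p(2) less_imp_le by blast
  qed
  then have min: "(norm (v - q))\<^sup>2 \<le> (norm (v - m))\<^sup>2" if "m \<in> M" for m
    using dle[OF that] by linarith
  have "(v - q) \<bullet> m = 0" if m: "m \<in> M" for m
  proof -
    have "0 \<le> t * (2 * ((v - q) \<bullet> m)) + t\<^sup>2 * (norm m)\<^sup>2" for t
    proof -
      have "q - t *\<^sub>R m \<in> M"
        using M qM m by (simp add: subspace_diff subspace_scale)
      from min[OF this] have "(norm (v - q))\<^sup>2 \<le> (norm ((v - q) + t *\<^sub>R m))\<^sup>2"
        by (simp add: algebra_simps)
      also have "\<dots> = (norm (v - q))\<^sup>2 + (t * (2 * ((v - q) \<bullet> m)) + t\<^sup>2 * (norm m)\<^sup>2)"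
        by (simp only: power2_norm_eq_inner inner_add_left inner_add_right inner_commute
            inner_scaleR_left inner_scaleR_right) (simp add: power2_eq_square inner_commute)
      finally show ?thesis by simp
    qed
    from linear_coeff_zero_of_quadratic_nonneg[OF this] show ?thesis by simp
  qed
  with qM show ?thesis by blast
qed

text \<open>
  A nonzero \<open>f\<close> vanishes on a hyperplane; any nonzero vector orthogonal to that hyperplane is, up to
  scaling, the representing one.
\<close>

lemma riesz_representation:
  fixes f :: "'a::{real_inner, banach} \<Rightarrow> real"
  assumes f: "bounded_linear f"
  shows "\<exists>g. \<forall>x. f x = x \<bullet> g"
proof (cases "\<forall>x. f x = 0")
  case True
  then show ?thesis by (intro exI[of _ 0]) simp
next
  case False
  then obtain v where v: "f v \<noteq> 0" by blast
  interpret f: bounded_linear f by (rule f)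
  let ?K = "{x. f x = 0}"
  have "subspace ?K"
    by (auto simp: subspace_def f.add f.scaleR)
  moreover have "closed ?K"
    by (intro closed_Collect_eq continuous_intros f.continuous_on)
  ultimately obtain p where p: "f p = 0" "\<And>m. f m = 0 \<Longrightarrow> (v - p) \<bullet> m = 0"
    using projection_exists[of ?K v] by blast
  define q where "q = v - p"
  have fq: "f q \<noteq> 0"
    using v p by (simp add: q_def f.diff)
  then have q0: "q \<bullet> q \<noteq> 0"
    by (auto simp: f.zero)
  show ?thesis
  proof (intro exI allI)
    fix x
    have "q \<bullet> (x - (f x / f q) *\<^sub>R q) = 0"
      unfolding q_def by (rule p(2)) (use fq in \<open>simp add: q_def f.diff f.scaleR\<close>)
    then have "q \<bullet> x = f x / f q * (q \<bullet> q)"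
      by (simp add: inner_diff_right)
    then show "f x = x \<bullet> ((f q / (q \<bullet> q)) *\<^sub>R q)"
      using fq q0 by (simp add: inner_commute field_simps)
  qed
qed

lemma adjoint_exists:
  fixes T :: "'a::{real_inner, banach} \<Rightarrow> 'b::real_inner"
  assumes T: "bounded_linear T"
  shows "\<exists>G. bounded_linear G \<and> (\<forall>x y. T x \<bullet> y = x \<bullet> G y)"
proof -
  have "\<exists>g. \<forall>x. T x \<bullet> y = x \<bullet> g" for y
    by (rule riesz_representation)
      (rule bounded_linear_compose[OF bounded_linear_inner_left T, unfolded o_def])
  then obtain G where G: "\<And>x y. T x \<bullet> y = x \<bullet> G y"
    by metis
  obtain K where K: "\<And>x. norm (T x) \<le> norm x * K" "K \<ge> 0"
    using bounded_linear.nonneg_bounded[OF T] by metis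
  have "bounded_linear G"
  proof (rule bounded_linear_intro)
    show "G (x + y) = G x + G y" for x y
      by (rule vector_eq_ldot[THEN iffD1]) (simp add: G[symmetric] inner_add_right)
    show "G (r *\<^sub>R x) = r *\<^sub>R G x" for r x
      by (rule vector_eq_ldot[THEN iffD1]) (simp add: G[symmetric])
    show "norm (G y) \<le> norm y * K" for y
    proof (cases "G y = 0")
      case False
      have "norm (G y) * norm (G y) = T (G y) \<bullet> y"
        by (simp add: G power2_norm_eq_inner[symmetric] power2_eq_square)
      also have "\<dots> \<le> norm (T (G y)) * norm y"
        by (rule norm_cauchy_schwarz)
      also have "\<dots> \<le> norm (G y) * K * norm y"
        using K(1) by (intro mult_right_mono) auto
      finally show ?thesis
        using False by (simp add: mult.assoc mult.commute)
    qed (use K in simp)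
  qed
  with G show ?thesis by blast
qed

lemma subspace_closure:
  fixes M :: "'a::real_normed_vector set"
  assumes M: "subspace M"
  shows "subspace (closure M)"
  unfolding subspace_def
proof (intro conjI ballI allI)
  show "0 \<in> closure M"
    using M closure_subset subspace_0 by blast
next
  fix x y assume "x \<in> closure M" "y \<in> closure M"
  then obtain u w where uw: "\<And>n. u n \<in> M" "u \<longlonglongrightarrow> x" "\<And>n. w n \<in> M" "w \<longlonglongrightarrow> y"
    unfolding closure_sequential by blast
  then show "x + y \<in> closure M"
    unfolding closure_sequential using M
    by (intro exI[of _ "\<lambda>n. u n + w n"]) (auto intro: tendsto_intros simp: subspace_add)
next
  fix c :: real and x assume "x \<in> closure M"
  then obtain u where u: "\<And>n. u n \<in> M" "u \<longlonglongrightarrow> x"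
    unfolding closure_sequential by blast
  then show "c *\<^sub>R x \<in> closure M"
    unfolding closure_sequential using M
    by (intro exI[of _ "\<lambda>n. c *\<^sub>R u n"]) (auto intro: tendsto_intros simp: subspace_scale)
qed

text \<open>
  This describes a defect space by a kernel condition that involves only \<open>D\<^sup>2\<close>, because a
  symmetric operator and its square have the same kernel.
\<close>

lemma closure_range_symmetric:
  fixes D :: "'a::{real_inner, banach} \<Rightarrow> 'a"
  assumes D: "bounded_linear D" and sym: "\<And>x y. D x \<bullet> y = x \<bullet> D y"
  shows "v \<in> closure (range D) \<longleftrightarrow> (\<forall>w. D w = 0 \<longrightarrow> v \<bullet> w = 0)"
proof
  assume v: "v \<in> closure (range D)"
  show "\<forall>w. D w = 0 \<longrightarrow> v \<bullet> w = 0"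
  proof (intro allI impI)
    fix w assume "D w = 0"
    then have "range D \<subseteq> {u. u \<bullet> w = 0}"
      by (auto simp: sym)
    moreover have "closed {u. u \<bullet> w = 0}"
      by (intro closed_Collect_eq continuous_intros)
    ultimately have "closure (range D) \<subseteq> {u. u \<bullet> w = 0}"
      by (rule closure_minimal)
    with v show "v \<bullet> w = 0" by auto
  qed
next
  assume v: "\<forall>w. D w = 0 \<longrightarrow> v \<bullet> w = 0"
  have "subspace (range D)"
    using D by (simp add: bounded_linear.linear linear_subspace_image)
  then have "subspace (closure (range D))"
    by (rule subspace_closure)
  then obtain p where p: "p \<in> closure (range D)"
      "\<And>m. m \<in> closure (range D) \<Longrightarrow> (v - p) \<bullet> m = 0"
    using projection_exists[of "closure (range D)" v] by auto
  have "D (v - p) \<bullet> w = 0" for w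
    using p(2)[of "D w"] closure_subset[of "range D"] by (auto simp: sym)
  then have "D (v - p) = 0"
    by (metis inner_eq_zero_iff)
  then have "v \<bullet> (v - p) = 0"
    using v by blast
  then have "(v - p) \<bullet> (v - p) = 0"
    using p(2)[OF p(1)] by (simp add: inner_diff_right[of "v - p"] inner_commute)
  then show "v \<in> closure (range D)"
    using p(1) by simp
qed

section \<open>Square roots by the binomial series\<close>

text \<open>
  The Taylor coefficients of \<open>(1 - t)\<^sup>1\<^sup>/\<^sup>2\<close> at \<open>t = 0\<close>.
\<close>

definition sqrt_coeff :: "nat \<Rightarrow> real"
  where "sqrt_coeff k = (1/2 gchoose k) * (- 1) ^ k"

lemma sqrt_coeff_0: "sqrt_coeff 0 = 1"
  by (simp add: sqrt_coeff_def)

text \<open>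
  The identity \<open>(1 - t)\<^sup>1\<^sup>/\<^sup>2 (1 - t)\<^sup>1\<^sup>/\<^sup>2 = 1 - t\<close>, coefficient by coefficient; it is
  the Vandermonde convolution.
\<close>

lemma sqrt_coeff_convolution:
  "(\<Sum>i\<le>k. sqrt_coeff i * sqrt_coeff (k - i)) = (if k = 0 then 1 else if k = 1 then - 1 else 0)"
proof -
  have "(\<Sum>i\<le>k. sqrt_coeff i * sqrt_coeff (k - i))
      = (\<Sum>i\<le>k. (- 1) ^ k * ((1/2 gchoose i) * (1/2 gchoose (k - i))))"
  proof (rule sum.cong)
    fix i assume "i \<in> {..k}"
    then have "(- 1 :: real) ^ i * (- 1) ^ (k - i) = (- 1) ^ k"
      by (simp flip: power_add)
    then show "sqrt_coeff i * sqrt_coeff (k - i)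
        = (- 1) ^ k * ((1/2 gchoose i) * (1/2 gchoose (k - i)))"
      by (simp add: sqrt_coeff_def algebra_simps)
  qed simp
  also have "\<dots> = (- 1) ^ k * ((1/2 + 1/2) gchoose k)"
    by (simp only: sum_distrib_left[symmetric] atMost_atLeast0 gbinomial_Vandermonde)
  also have "\<dots> = (- 1) ^ k * real (1 choose k)"
    by (simp add: binomial_gbinomial)
  also have "\<dots> = (if k = 0 then 1 else if k = 1 then - 1 else 0)"
    by (cases k) auto
  finally show ?thesis .
qed

lemma alternating_gbinomial_step:
  fixes a :: real
  shows "real (Suc k) * ((a gchoose Suc k) * (- 1) ^ Suc k)
    = (real k - a) * ((a gchoose k) * (- 1) ^ k)"
proof -
  have "real (Suc k) * (a gchoose Suc k) = (a - real k) * (a gchoose k)"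
    using gbinomial_mult_1[of a k] by (simp add: algebra_simps)
  then have "real (Suc k) * (a gchoose Suc k) * (- 1) ^ Suc k
      = (a - real k) * (a gchoose k) * (- 1) ^ Suc k"
    by simp
  then show ?thesis by (simp add: algebra_simps)
qed

lemma sqrt_coeff_nonpos:
  assumes "k > 0"
  shows "sqrt_coeff k \<le> 0"
  using assms
proof (induction k)
  case (Suc k)
  have "real (Suc k) * sqrt_coeff (Suc k) = (real k - 1/2) * sqrt_coeff k"
    unfolding sqrt_coeff_def by (rule alternating_gbinomial_step)
  also have "\<dots> \<le> 0"
    using Suc.IH by (cases "k = 0") (auto simp: sqrt_coeff_0 intro!: mult_nonneg_nonpos)
  finally show ?case
    by (simp add: mult_le_0_iff)
qed simp

text \<open>
  The partial sums are, up to sign, binomial coefficients of \<open>- 1/2\<close>: multiplication by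
  \<open>(1 - t)\<^sup>-\<^sup>1\<close> turns \<open>(1 - t)\<^sup>1\<^sup>/\<^sup>2\<close> into \<open>(1 - t)\<^sup>-\<^sup>1\<^sup>/\<^sup>2\<close>, all of whose coefficients are
  positive.
\<close>

lemma sum_sqrt_coeff_nonneg: "0 \<le> (\<Sum>k\<le>n. sqrt_coeff k)"
proof -
  have "0 \<le> ((- 1/2 :: real) gchoose n) * (- 1) ^ n"
  proof (induction n)
    case (Suc n)
    have "0 \<le> real (Suc n) * (((- 1/2) gchoose Suc n) * (- 1) ^ Suc n)"
      unfolding alternating_gbinomial_step using Suc.IH by (intro mult_nonneg_nonneg[of "_ - _"]) auto
    then show ?case
      by (simp add: zero_le_mult_iff del: power_Suc of_nat_Suc)
  qed simp
  then show ?thesis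
    using gbinomial_sum_lower_neg[of "1/2 :: real" n]
    by (simp add: sqrt_coeff_def mult.commute[of "(- 1) ^ n"])
qed

lemma abs_summable_sqrt_coeff: "(\<lambda>k. \<bar>sqrt_coeff k\<bar>) summable_on UNIV"
proof -
  have "summable (\<lambda>k. \<bar>sqrt_coeff k\<bar>)"
  proof (rule bounded_imp_summable)
    fix n
    \<comment> \<open>Only the coefficient at \<open>0\<close>, equal to \<open>1\<close>, is positive; this accounts for the \<open>2\<close>.\<close>
    have "\<bar>sqrt_coeff k\<bar> = (if k = 0 then 2 else 0) - sqrt_coeff k" for k
      using sqrt_coeff_nonpos[of k] by (auto simp: sqrt_coeff_0)
    then have "(\<Sum>k\<le>n. \<bar>sqrt_coeff k\<bar>) = 2 - (\<Sum>k\<le>n. sqrt_coeff k)"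
      by (simp add: sum_subtractf sum.delta)
    then show "(\<Sum>k\<le>n. \<bar>sqrt_coeff k\<bar>) \<le> 2"
      using sum_sqrt_coeff_nonneg[of n] by simp
  qed simp
  then show ?thesis
    by (intro norm_summable_imp_summable_on) simp
qed

lemma summable_sqrt_coeff: "sqrt_coeff summable_on UNIV"
  by (rule abs_summable_summable) (use abs_summable_sqrt_coeff in simp)

lemma infsum_sqrt_coeff_nonneg: "0 \<le> (\<Sum>\<^sub>\<infinity>k. sqrt_coeff k)"
proof -
  from summable_sqrt_coeff have "sqrt_coeff sums (\<Sum>\<^sub>\<infinity>k. sqrt_coeff k)"
    by (simp add: has_sum_imp_sums)
  then have "(\<lambda>n. \<Sum>k\<le>n. sqrt_coeff k) \<longlonglongrightarrow> (\<Sum>\<^sub>\<infinity>k. sqrt_coeff k)"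
    by (simp add: sums_def_le)
  then show ?thesis
    by (rule LIMSEQ_le_const) (use sum_sqrt_coeff_nonneg in auto)
qed

text \<open>
  The Cauchy product for two power series evaluated at the same power bounded operator, with
  \<open>v k\<close> in the place of the \<open>k\<close>-th power applied to a vector.
\<close>

lemma Cauchy_product_bounded_sequence:
  fixes a b :: "nat \<Rightarrow> real" and v :: "nat \<Rightarrow> 'a::banach"
  assumes a: "(\<lambda>k. \<bar>a k\<bar>) summable_on UNIV" and b: "(\<lambda>k. \<bar>b k\<bar>) summable_on UNIV"
    and v: "\<And>k. norm (v k) \<le> K"
  shows "(\<Sum>\<^sub>\<infinity>i. a i *\<^sub>R (\<Sum>\<^sub>\<infinity>j. b j *\<^sub>R v (i + j))) = (\<Sum>\<^sub>\<infinity>k. (\<Sum>i\<le>k. a i * b (k - i)) *\<^sub>R v k)"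
proof -
  define f where "f = (\<lambda>(i, j). (a i * b j) *\<^sub>R v (i + j))"
  have "(\<lambda>(i, j). (\<bar>a i\<bar> * \<bar>b j\<bar>) * K) summable_on UNIV \<times> UNIV"
    by (intro summable_on_SigmaI[where g = "\<lambda>i. \<bar>a i\<bar> * (\<Sum>\<^sub>\<infinity>j. \<bar>b j\<bar>) * K"])
      (use v[of 0] norm_ge_zero[of "v 0"] in \<open>auto intro!: has_sum_cmult_left has_sum_cmult_right
        summable_on_cmult_left summable_on_cmult_right a b mult_nonneg_nonneg has_sum_infsum
        simp del: norm_ge_zero\<close>)
  then have "(\<lambda>p. norm (f p)) summable_on UNIV \<times> UNIV"
    by (rule Infinite_Sum.abs_summable_on_comparison_test')
      (auto simp: f_def abs_mult intro!: mult_left_mono v)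
  then have f: "f summable_on UNIV \<times> UNIV"
    by (rule abs_summable_summable)
  have eq: "f = (\<lambda>(i, j). f (i, j))"
    by simp
  have "(\<Sum>\<^sub>\<infinity>i. a i *\<^sub>R (\<Sum>\<^sub>\<infinity>j. b j *\<^sub>R v (i + j))) = (\<Sum>\<^sub>\<infinity>i. \<Sum>\<^sub>\<infinity>j. f (i, j))"
    by (simp add: f_def infsum_scaleR_right[symmetric])
  also have "\<dots> = infsum f (UNIV \<times> UNIV)"
    by (rule infsum_Sigma_banach) (rule f)
  \<comment> \<open>Absolute summability over all pairs allows regrouping along the diagonals \<open>i + j = k\<close>.\<close>
  also have "\<dots> = infsum (\<lambda>(k, i). f (i, k - i)) (SIGMA k:UNIV. {..k})"
    by (rule infsum_reindex_bij_witness[of _ "\<lambda>(k, i). (i, k - i)" "\<lambda>(i, j). (i + j, i)"]) auto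
  also have "\<dots> = (\<Sum>\<^sub>\<infinity>k. \<Sum>\<^sub>\<infinity>i\<in>{..k}. f (i, k - i))"
  proof (rule infsum_Sigma'_banach[symmetric])
    show "(\<lambda>(k, i). f (i, k - i)) summable_on (SIGMA k:UNIV. {..k})"
      using f by (subst (asm) summable_on_reindex_bij_witness[of _ "\<lambda>(k, i). (i, k - i)"
            "\<lambda>(i, j). (i + j, i)" "SIGMA k:UNIV. {..k}" "\<lambda>(k, i). f (i, k - i)"]) auto
  qed
  also have "\<dots> = (\<Sum>\<^sub>\<infinity>k. (\<Sum>i\<le>k. a i * b (k - i)) *\<^sub>R v k)"
    by (simp add: f_def scaleR_sum_left)
  finally show ?thesis .
qed

lemma infsum_bounded_linear:
  fixes h :: "'a::real_normed_vector \<Rightarrow> 'b::real_normed_vector"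
  assumes "bounded_linear h" "f summable_on A"
  shows "(\<Sum>\<^sub>\<infinity>x\<in>A. h (f x)) = h (infsum f A)"
  using assms by (simp add: infsum_bounded_linear_strong summable_on_bounded_linear)

definition sqrt_one_minus :: "('a::{real_inner, banach} \<Rightarrow> 'a) \<Rightarrow> 'a \<Rightarrow> 'a"
  where "sqrt_one_minus B x = (\<Sum>\<^sub>\<infinity>k. sqrt_coeff k *\<^sub>R (B ^^ k) x)"

text \<open>
  The nonnegative quadratic \<open>t \<mapsto> \<langle>P (y + t P y), y + t P y\<rangle>\<close> vanishes at \<open>t = 0\<close>, so its
  linear coefficient \<open>2 \<parallel>P y\<parallel>\<^sup>2\<close> must be zero.
\<close>

lemma symmetric_nonneg_kernel:
  fixes P :: "'b::real_inner \<Rightarrow> 'b"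
  assumes P: "bounded_linear P" "\<And>x y. P x \<bullet> y = x \<bullet> P y" "\<And>x. 0 \<le> P x \<bullet> x"
    and y: "P y \<bullet> y = 0"
  shows "P y = 0"
proof -
  have "0 \<le> t * (2 * (P y \<bullet> P y)) + t\<^sup>2 * (P (P y) \<bullet> P y)" for t
  proof -
    have "P (y + t *\<^sub>R P y) \<bullet> (y + t *\<^sub>R P y)
        = t * (2 * (P y \<bullet> P y)) + t\<^sup>2 * (P (P y) \<bullet> P y)"
      using y P(2)[of "P y" y]
      by (simp add: linear_add[OF bounded_linear.linear[OF P(1)]]
          linear_scale[OF bounded_linear.linear[OF P(1)]] inner_add_left inner_add_right
          power2_eq_square algebra_simps)
    then show ?thesis
      using P(3)[of "y + t *\<^sub>R P y"] by simp
  qed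
  from linear_coeff_zero_of_quadratic_nonneg[OF this] show ?thesis
    by simp
qed

context
  fixes B :: "'a::{real_inner, banach} \<Rightarrow> 'a"
  assumes lin: "bounded_linear B"
    and contr: "\<And>x. norm (B x) \<le> norm x"
begin

lemma bounded_linear_funpow: "bounded_linear (B ^^ k)"
proof (induction k)
  case (Suc k)
  show ?case
    using bounded_linear_compose[OF lin Suc.IH] by (simp add: o_def)
qed (simp add: id_def)

lemma norm_funpow_le: "norm ((B ^^ k) x) \<le> norm x"
  by (induction k) (auto intro: order_trans[OF contr])

lemma abs_summable_sqrt_series:
  "(\<lambda>k. norm (sqrt_coeff k *\<^sub>R (B ^^ k) x)) summable_on UNIV"
  by (rule Infinite_Sum.abs_summable_on_comparison_test'[OF
        summable_on_cmult_left[OF abs_summable_sqrt_coeff]])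
    (auto intro!: mult_left_mono norm_funpow_le)

lemma summable_sqrt_series: "(\<lambda>k. sqrt_coeff k *\<^sub>R (B ^^ k) x) summable_on UNIV"
  by (rule abs_summable_summable[OF abs_summable_sqrt_series])

lemma sqrt_one_minus_commute:
  assumes L: "bounded_linear L" and comm: "\<And>x. L (B x) = B (L x)"
  shows "L (sqrt_one_minus B x) = sqrt_one_minus B (L x)"
proof -
  have "L ((B ^^ k) x) = (B ^^ k) (L x)" for k
    by (induction k) (simp_all add: comm)
  then show ?thesis
    unfolding sqrt_one_minus_def
    by (subst infsum_bounded_linear[OF L summable_sqrt_series, symmetric])
      (simp add: linear_scale[OF bounded_linear.linear[OF L]])
qed

lemma bounded_linear_sqrt_one_minus: "bounded_linear (sqrt_one_minus B)"
proof (rule bounded_linear_intro)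
  show "sqrt_one_minus B (x + y) = sqrt_one_minus B x + sqrt_one_minus B y" for x y
    unfolding sqrt_one_minus_def
    by (subst infsum_add[symmetric])
      (simp_all add: summable_sqrt_series scaleR_add_right
        linear_add[OF bounded_linear.linear[OF bounded_linear_funpow]])
  show "sqrt_one_minus B (r *\<^sub>R x) = r *\<^sub>R sqrt_one_minus B x" for r x
    by (rule sqrt_one_minus_commute[symmetric])
      (simp_all add: bounded_linear_scaleR_right linear_scale[OF bounded_linear.linear[OF lin]])
  show "norm (sqrt_one_minus B x) \<le> norm x * (\<Sum>\<^sub>\<infinity>k. \<bar>sqrt_coeff k\<bar>)" for x
  proof -
    have "norm (sqrt_one_minus B x) \<le> (\<Sum>\<^sub>\<infinity>k. norm (sqrt_coeff k *\<^sub>R (B ^^ k) x))"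
      unfolding sqrt_one_minus_def by (rule norm_infsum_bound[OF abs_summable_sqrt_series])
    also have "\<dots> \<le> (\<Sum>\<^sub>\<infinity>k. norm x * \<bar>sqrt_coeff k\<bar>)"
      by (rule infsum_mono[OF abs_summable_sqrt_series
            summable_on_cmult_right[OF abs_summable_sqrt_coeff]])
        (simp add: norm_funpow_le mult_left_mono mult.commute[of "norm x"])
    finally show ?thesis
      by (simp add: infsum_cmult_right')
  qed
qed

lemma sqrt_one_minus_square: "sqrt_one_minus B (sqrt_one_minus B x) = x - B x"
proof -
  have "sqrt_one_minus B (sqrt_one_minus B x)
      = (\<Sum>\<^sub>\<infinity>i. sqrt_coeff i *\<^sub>R (\<Sum>\<^sub>\<infinity>j. sqrt_coeff j *\<^sub>R (B ^^ (i + j)) x))"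
  proof -
    have "(B ^^ i) (sqrt_one_minus B x) = (\<Sum>\<^sub>\<infinity>j. sqrt_coeff j *\<^sub>R (B ^^ (i + j)) x)" for i
      by (subst sqrt_one_minus_commute[OF bounded_linear_funpow])
        (simp_all add: sqrt_one_minus_def funpow_swap1 funpow_add add.commute)
    then show ?thesis
      by (simp add: sqrt_one_minus_def[of B "sqrt_one_minus B x"])
  qed
  also have "\<dots> = (\<Sum>\<^sub>\<infinity>k. (if k = 0 then 1 else if k = 1 then - 1 else 0) *\<^sub>R (B ^^ k) x)"
    by (subst Cauchy_product_bounded_sequence[OF abs_summable_sqrt_coeff abs_summable_sqrt_coeff
          norm_funpow_le]) (simp add: sqrt_coeff_convolution)
  also have "\<dots> = (\<Sum>\<^sub>\<infinity>k\<in>{0, 1}. (if k = 0 then 1 else if k = 1 then - 1 else 0) *\<^sub>R (B ^^ k) x)"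
    by (rule infsum_cong_neutral) auto
  also have "\<dots> = x - B x"
    by simp
  finally show ?thesis .
qed

context
  assumes sym: "\<And>x y. B x \<bullet> y = x \<bullet> B y"
begin

lemma sqrt_one_minus_symmetric: "sqrt_one_minus B x \<bullet> y = x \<bullet> sqrt_one_minus B y"
proof -
  have pow: "(B ^^ k) x \<bullet> y = x \<bullet> (B ^^ k) y" for k x y
    by (induction k arbitrary: x y) (simp_all add: sym funpow_swap1)
  have "sqrt_one_minus B x \<bullet> y = (\<Sum>\<^sub>\<infinity>k. sqrt_coeff k *\<^sub>R (B ^^ k) x \<bullet> y)"
    unfolding sqrt_one_minus_def
    by (rule infsum_bounded_linear[OF bounded_linear_inner_left summable_sqrt_series, symmetric])
  also have "\<dots> = (\<Sum>\<^sub>\<infinity>k. x \<bullet> sqrt_coeff k *\<^sub>R (B ^^ k) y)"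
    by (simp add: pow)
  also have "\<dots> = x \<bullet> sqrt_one_minus B y"
    unfolding sqrt_one_minus_def
    by (rule infsum_bounded_linear[OF bounded_linear_inner_right summable_sqrt_series])
  finally show ?thesis .
qed

text \<open>
  Every \<open>\<langle>B\<^sup>k x, x\<rangle>\<close> is at most \<open>\<parallel>x\<parallel>\<^sup>2\<close>, with equality for \<open>k = 0\<close>, and only the coefficient
  with \<open>k = 0\<close> is positive. Hence replacing all of them by \<open>\<parallel>x\<parallel>\<^sup>2\<close> can only decrease the sum.
\<close>

lemma sqrt_one_minus_nonneg: "0 \<le> sqrt_one_minus B x \<bullet> x"
proof -
  have le: "(B ^^ k) x \<bullet> x \<le> x \<bullet> x" for k
  proof -
    have "(B ^^ k) x \<bullet> x \<le> norm ((B ^^ k) x) * norm x"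
      by (rule norm_cauchy_schwarz)
    also have "\<dots> \<le> norm x * norm x"
      by (intro mult_right_mono norm_funpow_le) auto
    finally show ?thesis
      by (simp add: dot_square_norm power2_eq_square)
  qed
  have "0 \<le> (\<Sum>\<^sub>\<infinity>k. sqrt_coeff k) * (x \<bullet> x)"
    by (intro mult_nonneg_nonneg infsum_sqrt_coeff_nonneg) auto
  also have "\<dots> = (\<Sum>\<^sub>\<infinity>k. sqrt_coeff k * (x \<bullet> x))"
    by (rule infsum_cmult_left'[symmetric])
  also have "\<dots> \<le> (\<Sum>\<^sub>\<infinity>k. sqrt_coeff k *\<^sub>R (B ^^ k) x \<bullet> x)"
  proof (rule infsum_mono)
    show "(\<lambda>k. sqrt_coeff k * (x \<bullet> x)) summable_on UNIV"
      by (intro summable_on_cmult_left summable_sqrt_coeff)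
    show "(\<lambda>k. sqrt_coeff k *\<^sub>R (B ^^ k) x \<bullet> x) summable_on UNIV"
      by (rule summable_on_bounded_linear[OF bounded_linear_inner_left summable_sqrt_series])
    show "sqrt_coeff k * (x \<bullet> x) \<le> sqrt_coeff k *\<^sub>R (B ^^ k) x \<bullet> x" for k
      by (cases "k = 0") (auto intro!: mult_left_mono_neg le sqrt_coeff_nonpos)
  qed
  also have "\<dots> = sqrt_one_minus B x \<bullet> x"
    unfolding sqrt_one_minus_def
    by (rule infsum_bounded_linear[OF bounded_linear_inner_left summable_sqrt_series])
  finally show ?thesis .
qed

text \<open>
  A root \<open>P\<close> commutes with \<open>B = I - P\<^sup>2\<close>, hence with the series \<open>R\<close>, so that
  \<open>(R + P) (R - P) = R\<^sup>2 - P\<^sup>2 = 0\<close>. On the range of \<open>R - P\<close> the sum of the two nonnegative forms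
  vanishes, so both operators do, and \<open>(R - P)\<^sup>2 = 0\<close>.
\<close>

lemma sqrt_one_minus_unique:
  assumes P: "bounded_linear P" "\<And>x y. P x \<bullet> y = x \<bullet> P y" "\<And>x. 0 \<le> P x \<bullet> x"
    and sq: "\<And>x. P (P x) = x - B x"
  shows "P = sqrt_one_minus B"
proof
  fix x
  let ?R = "sqrt_one_minus B"
  interpret P: bounded_linear P by (rule P(1))
  interpret R: bounded_linear ?R by (rule bounded_linear_sqrt_one_minus)
  have "B x = x - P (P x)" for x
    using sq[of x] by simp
  then have "P (B x) = B (P x)" for x
    by (simp add: P.diff)
  then have comm: "P (?R x) = ?R (P x)" for x
    by (rule sqrt_one_minus_commute[OF P(1)])
  define y where "y = ?R x - P x"
  have "?R y + P y = 0"
    by (simp add: y_def R.diff P.diff comm sq sqrt_one_minus_square)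
  then have "?R y \<bullet> y + P y \<bullet> y = 0"
    by (metis inner_add_left inner_zero_left)
  then have "?R y \<bullet> y = 0" "P y \<bullet> y = 0"
    using P(3)[of y] sqrt_one_minus_nonneg[of y] by auto
  then have "?R y = 0" "P y = 0"
    by (auto intro: symmetric_nonneg_kernel[OF P]
        symmetric_nonneg_kernel[OF R.bounded_linear_axioms sqrt_one_minus_symmetric
          sqrt_one_minus_nonneg])
  moreover have "y \<bullet> y = x \<bullet> ?R y - x \<bullet> P y"
    by (subst (1) y_def) (simp add: inner_diff_left sqrt_one_minus_symmetric P(2))
  ultimately have "y \<bullet> y = 0"
    by simp
  then show "P x = ?R x"
    by (simp add: y_def)
qed

end

end

section \<open>Complex Hilbert spaces and adjoints\<close>

instance chilbert_space \<subseteq> banach ..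

lemma cinner_scaleC_right: "cinner x (c *\<^sub>C y) = cnj c * cinner x y"
  by (metis cinner_commute cinner_scaleC_left complex_cnj_mult)

lemma scaleC_one: "1 *\<^sub>C x = x"
  using scaleR_scaleC[of 1 x] by simp

lemma scaleC_zero_left: "0 *\<^sub>C x = 0"
  using scaleR_scaleC[of 0 x] by simp

lemma scaleC_minus_one: "(- 1) *\<^sub>C x = - x"
  using scaleR_scaleC[of "- 1" x] by simp

text \<open>
  Since the real inner product determines the complex one, identities between complex linear
  operators may be checked for the real inner product.
\<close>

lemma cinner_eq_inner: "cinner x y = Complex (x \<bullet> y) (x \<bullet> (\<i> *\<^sub>C y))"
  by (simp add: complex_eq_iff inner_eq_Re_cinner cinner_scaleC_right)

lemma inner_scaleC_left: "(c *\<^sub>C x) \<bullet> y = x \<bullet> (cnj c *\<^sub>C y)"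
  by (simp add: inner_eq_Re_cinner cinner_scaleC_left cinner_scaleC_right)

lemma norm_scaleC: "norm (c *\<^sub>C x) = cmod c * norm x"
proof -
  have "cnj c *\<^sub>C c *\<^sub>C x = (cmod c)\<^sup>2 *\<^sub>R x"
    by (simp add: scaleC_scaleC scaleR_scaleC complex_norm_square[symmetric] mult.commute
        del: of_real_power)
  then have "(c *\<^sub>C x) \<bullet> (c *\<^sub>C x) = (cmod c)\<^sup>2 * (x \<bullet> x)"
    by (simp add: inner_scaleC_left)
  then have "(norm (c *\<^sub>C x))\<^sup>2 = (cmod c * norm x)\<^sup>2"
    by (simp add: power2_norm_eq_inner power_mult_distrib)
  then show ?thesis
    by simp
qed

lemma bounded_linear_scaleC: "bounded_linear (\<lambda>x. c *\<^sub>C x)"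
proof (rule bounded_linear_intro)
  show "c *\<^sub>C (r *\<^sub>R x) = r *\<^sub>R (c *\<^sub>C x)" for r and x :: 'a
    by (simp add: scaleR_scaleC scaleC_scaleC mult.commute)
  show "norm (c *\<^sub>C x) \<le> norm x * cmod c" for x :: 'a
    by (simp add: norm_scaleC)
qed (rule scaleC_add_right)

lemma mem_orthogonal_comp: "h \<in> orthogonal_comp M \<longleftrightarrow> (\<forall>x\<in>M. x \<bullet> h = 0)"
  by (simp add: orthogonal_comp_def orthogonal_def)

lemma closed_csubspace_orthogonal_comp:
  assumes M: "\<And>c x. x \<in> M \<Longrightarrow> c *\<^sub>C x \<in> M"
  shows "closed_csubspace (orthogonal_comp M)"
  unfolding closed_csubspace_def
proof (intro conjI allI ballI)
  show "subspace (orthogonal_comp M)"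
    by (rule subspace_orthogonal_comp)
  show "closed (orthogonal_comp M)"
  proof -
    have "orthogonal_comp M = (\<Inter>x\<in>M. {h. x \<bullet> h = 0})"
      by (auto simp: mem_orthogonal_comp)
    then show ?thesis
      by (auto intro!: closed_INT closed_Collect_eq continuous_intros)
  qed
  show "c *\<^sub>C h \<in> orthogonal_comp M" if h: "h \<in> orthogonal_comp M" for c h
  proof -
    have "x \<bullet> (c *\<^sub>C h) = 0" if "x \<in> M" for x
      using h M[OF that, of "cnj c"] inner_scaleC_left[of "cnj c" x h]
      by (simp add: mem_orthogonal_comp)
    then show ?thesis
      by (simp add: mem_orthogonal_comp)
  qed
qed

lemma bounded_ops_UNIV_iff:
  "f \<in> bounded_ops UNIV UNIV \<longleftrightarrow> bounded_linear f \<and> (\<forall>c x. f (c *\<^sub>C x) = c *\<^sub>C f x)"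
proof
  assume f: "f \<in> bounded_ops UNIV UNIV"
  then obtain b where b: "\<And>x. norm (f x) \<le> b * norm x"
    by (auto simp: bounded_ops_def)
  have "bounded_linear f"
    by (rule bounded_linear_intro[where K = b])
      (use f b in \<open>auto simp: bounded_ops_def scaleR_scaleC mult.commute\<close>)
  with f show "bounded_linear f \<and> (\<forall>c x. f (c *\<^sub>C x) = c *\<^sub>C f x)"
    by (auto simp: bounded_ops_def)
next
  assume f: "bounded_linear f \<and> (\<forall>c x. f (c *\<^sub>C x) = c *\<^sub>C f x)"
  then obtain b where "\<And>x. norm (f x) \<le> norm x * b"
    using bounded_linear.bounded by blast
  then have "\<forall>x. norm (f x) \<le> b * norm x"
    by (simp add: mult.commute)
  with f show "f \<in> bounded_ops UNIV UNIV"
    by (auto simp: bounded_ops_def linear_add[OF bounded_linear.linear])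
qed

lemma bounded_ops_UNIV_restrict:
  assumes "f \<in> bounded_ops UNIV UNIV" and "\<And>x. x \<in> M \<Longrightarrow> f x \<in> K"
  shows "f \<in> bounded_ops M K"
  using assms by (auto simp: bounded_ops_def)

lemma bounded_ops_zero:
  assumes "f \<in> bounded_ops M K" "0 \<in> M"
  shows "f 0 = 0"
  using assms unfolding bounded_ops_def by (metis (mono_tags, lifting) mem_Collect_eq scaleC_zero_left)

lemma bounded_ops_comp:
  assumes "f \<in> bounded_ops UNIV UNIV" "g \<in> bounded_ops UNIV UNIV"
  shows "(\<lambda>x. f (g x)) \<in> bounded_ops UNIV UNIV"
  using assms by (auto simp: bounded_ops_UNIV_iff bounded_linear_compose)

lemma bounded_ops_funpow:
  fixes f :: "'a::complex_inner \<Rightarrow> 'a"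
  assumes "f \<in> bounded_ops UNIV UNIV"
  shows "f ^^ k \<in> bounded_ops UNIV UNIV"
proof (induction k)
  case (Suc k)
  then show ?case
    using bounded_ops_comp[OF assms] by (simp add: o_def)
qed (simp add: bounded_ops_UNIV_iff id_def)

lemma
  fixes T :: "'a::chilbert_space \<Rightarrow> 'a"
  assumes T: "T \<in> bounded_ops UNIV UNIV"
  shows cadjoint_bounded: "cadjoint T \<in> bounded_ops UNIV UNIV"
    and cinner_cadjoint: "cinner (T x) y = cinner x (cadjoint T y)"
proof -
  have lin: "bounded_linear T" and scale: "\<And>c x. T (c *\<^sub>C x) = c *\<^sub>C T x"
    using T by (auto simp: bounded_ops_UNIV_iff)
  obtain G where G: "bounded_linear G" "\<And>x y. T x \<bullet> y = x \<bullet> G y"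
    using adjoint_exists[OF lin] by blast
  have Gscale: "G (c *\<^sub>C y) = c *\<^sub>C G y" for c y
  proof (rule vector_eq_ldot[THEN iffD1], rule allI)
    fix x
    have "x \<bullet> G (c *\<^sub>C y) = T (cnj c *\<^sub>C x) \<bullet> y"
      by (simp add: scale inner_scaleC_left flip: G(2))
    also have "\<dots> = x \<bullet> (c *\<^sub>C G y)"
      by (simp add: G(2) inner_scaleC_left)
    finally show "x \<bullet> G (c *\<^sub>C y) = x \<bullet> (c *\<^sub>C G y)" .
  qed
  have "\<exists>G. G \<in> bounded_ops UNIV UNIV \<and> (\<forall>x\<in>UNIV. \<forall>y\<in>UNIV. cinner (T x) y = cinner x (G y))"
  proof (intro exI[of _ G] conjI ballI)
    show "G \<in> bounded_ops UNIV UNIV"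
      unfolding bounded_ops_UNIV_iff using G(1) Gscale by blast
    show "cinner (T x) y = cinner x (G y)" for x y
      unfolding cinner_eq_inner[of "T x"] cinner_eq_inner[of x] by (simp only: G(2) Gscale)
  qed
  from someI_ex[OF this] show "cadjoint T \<in> bounded_ops UNIV UNIV"
      "cinner (T x) y = cinner x (cadjoint T y)"
    unfolding adjoint_on_def by blast+
qed

text \<open>
  The adjoint is chosen by Hilbert choice, and only its values on \<open>M\<close> are determined; any
  operator that satisfies the adjoint relation on \<open>M\<close> computes them.
\<close>

lemma adjoint_on_eq:
  assumes M: "subspace M" and G: "G \<in> bounded_ops M M"
    and adj: "\<And>x y. x \<in> M \<Longrightarrow> y \<in> M \<Longrightarrow> cinner (f x) y = cinner x (G y)"
    and y: "y \<in> M"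
  shows "adjoint_on M M f y = G y"
proof -
  let ?G = "adjoint_on M M f"
  have "\<exists>G. G \<in> bounded_ops M M \<and> (\<forall>x\<in>M. \<forall>y\<in>M. cinner (f x) y = cinner x (G y))"
    using G adj by blast
  from someI_ex[OF this] have F: "?G \<in> bounded_ops M M"
      "\<And>x y. x \<in> M \<Longrightarrow> y \<in> M \<Longrightarrow> cinner (f x) y = cinner x (?G y)"
    unfolding adjoint_on_def by blast+
  have "?G y \<in> M" "G y \<in> M"
    using F(1) G y by (auto simp: bounded_ops_def)
  then have d: "?G y - G y \<in> M"
    using M by (simp add: subspace_diff)
  then have "cinner (?G y - G y) (?G y) = cinner (?G y - G y) (G y)"
    using F(2) adj y by metis
  then have "(?G y - G y) \<bullet> ?G y = (?G y - G y) \<bullet> G y"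
    by (simp only: inner_eq_Re_cinner)
  then have "(?G y - G y) \<bullet> (?G y - G y) = 0"
    by (simp add: inner_diff_right[of "?G y - G y"])
  then show ?thesis
    by simp
qed

text \<open>
  By polarization with the scalars \<open>1\<close> and \<open>\<i>\<close>, an operator with real quadratic form is symmetric.
\<close>

lemma positive_op_iff:
  "positive_op A \<longleftrightarrow> A \<in> bounded_ops UNIV UNIV \<and> (\<forall>x y. A x \<bullet> y = x \<bullet> A y) \<and> (\<forall>x. 0 \<le> A x \<bullet> x)"
proof (cases "A \<in> bounded_ops UNIV UNIV")
  case True
  then have lin: "bounded_linear A" and scale: "\<And>c x. A (c *\<^sub>C x) = c *\<^sub>C A x"
    by (auto simp: bounded_ops_UNIV_iff)
  interpret A: bounded_linear A by (rule lin)
  have "(\<forall>x. cinner (A x) x \<in> \<real>) \<longleftrightarrow> (\<forall>x y. A x \<bullet> y = x \<bullet> A y)"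
  proof
    assume real: "\<forall>x. cinner (A x) x \<in> \<real>"
    have im: "A x \<bullet> (\<i> *\<^sub>C x) = 0" for x
      using real[rule_format, of x] by (simp add: complex_is_Real_iff cinner_eq_inner)
    \<comment> \<open>The imaginary part of \<open>\<langle>A x, x\<rangle>\<close> vanishes at \<open>x + y\<close>, at \<open>x\<close> and at \<open>y\<close>.\<close>
    have swap: "A x \<bullet> (\<i> *\<^sub>C y) = - (A y \<bullet> (\<i> *\<^sub>C x))" for x y
      using im[of "x + y"] im[of x] im[of y]
      by (simp add: A.add scaleC_add_right inner_add_left inner_add_right)
    show "\<forall>x y. A x \<bullet> y = x \<bullet> A y"
    proof (intro allI)
      fix x y
      have ii: "\<i> *\<^sub>C \<i> *\<^sub>C v = - v" for v :: 'a
        by (simp add: scaleC_scaleC scaleC_minus_one)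
      have "A x \<bullet> (\<i> *\<^sub>C \<i> *\<^sub>C y) = - (A (\<i> *\<^sub>C y) \<bullet> (\<i> *\<^sub>C x))"
        by (rule swap)
      also have "\<dots> = - (A y \<bullet> x)"
        by (simp add: scale inner_scaleC_left scaleC_scaleC scaleC_one)
      finally show "A x \<bullet> y = x \<bullet> A y"
        by (simp add: ii inner_commute)
    qed
  next
    assume sym: "\<forall>x y. A x \<bullet> y = x \<bullet> A y"
    have "A x \<bullet> (\<i> *\<^sub>C x) = 0" for x
    proof -
      have "A x \<bullet> (\<i> *\<^sub>C x) = x \<bullet> (\<i> *\<^sub>C A x)"
        using sym by (simp add: scale)
      also have "\<dots> = (\<i> *\<^sub>C A x) \<bullet> x"
        by (rule inner_commute)
      also have "\<dots> = A x \<bullet> ((- 1) *\<^sub>C \<i> *\<^sub>C x)"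
        by (simp add: inner_scaleC_left scaleC_scaleC)
      also have "\<dots> = - (A x \<bullet> (\<i> *\<^sub>C x))"
        by (simp add: scaleC_minus_one)
      finally show ?thesis by simp
    qed
    then show "\<forall>x. cinner (A x) x \<in> \<real>"
      by (simp add: complex_is_Real_iff cinner_eq_inner)
  qed
  with True show ?thesis
    by (auto simp: positive_op_def inner_eq_Re_cinner)
qed (simp add: positive_op_def)

lemma
  fixes B :: "'a::chilbert_space \<Rightarrow> 'a"
  assumes B: "B \<in> bounded_ops UNIV UNIV" and contr: "\<And>x. norm (B x) \<le> norm x"
    and sym: "\<And>x y. B x \<bullet> y = x \<bullet> B y"
  shows positive_sqrt_op: "positive_op (sqrt_op (\<lambda>x. x - B x))"
    and sqrt_op_square: "sqrt_op (\<lambda>x. x - B x) (sqrt_op (\<lambda>x. x - B x) x) = x - B x"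
proof -
  let ?R = "sqrt_one_minus B"
  have lin: "bounded_linear B" and scale: "\<And>c x. B (c *\<^sub>C x) = c *\<^sub>C B x"
    using B by (auto simp: bounded_ops_UNIV_iff)
  \<comment> \<open>Scalar multiplication is a bounded real linear operator that commutes with \<open>B\<close>.\<close>
  have Rscale: "?R (c *\<^sub>C x) = c *\<^sub>C ?R x" for c x
    by (rule sqrt_one_minus_commute[OF lin contr bounded_linear_scaleC, symmetric])
      (simp add: scale)
  have pos: "positive_op ?R"
    unfolding positive_op_iff bounded_ops_UNIV_iff
    using bounded_linear_sqrt_one_minus[OF lin contr] Rscale
      sqrt_one_minus_symmetric[OF lin contr sym] sqrt_one_minus_nonneg[OF lin contr sym]
    by blast
  have sq: "?R (?R x) = x - B x" for x
    by (rule sqrt_one_minus_square[OF lin contr])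
  have "sqrt_op (\<lambda>x. x - B x) = ?R"
    unfolding sqrt_op_def
  proof (rule the_equality)
    show "positive_op ?R \<and> ?R \<circ> ?R = (\<lambda>x. x - B x)"
      using pos sq by (simp add: fun_eq_iff)
    fix P assume P: "positive_op P \<and> P \<circ> P = (\<lambda>x. x - B x)"
    then have "bounded_linear P" "\<And>x y. P x \<bullet> y = x \<bullet> P y" "\<And>x. 0 \<le> P x \<bullet> x"
        "\<And>x. P (P x) = x - B x"
      by (auto simp: positive_op_iff bounded_ops_UNIV_iff fun_eq_iff)
    then show "P = ?R"
      by (rule sqrt_one_minus_unique[OF lin contr sym])
  qed
  with pos sq show "positive_op (sqrt_op (\<lambda>x. x - B x))"
      "sqrt_op (\<lambda>x. x - B x) (sqrt_op (\<lambda>x. x - B x) x) = x - B x"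
    by simp_all
qed

section \<open>Defect operators of a contraction\<close>

context
  fixes T :: "'a::chilbert_space \<Rightarrow> 'a"
  assumes T: "contraction T"
begin

lemma contraction_bounded: "T \<in> bounded_ops UNIV UNIV"
  using T by (simp add: contraction_def)

lemma contraction_norm: "norm (T x) \<le> norm x"
  using T by (simp add: contraction_def)

lemma inner_cadjoint: "T x \<bullet> y = x \<bullet> cadjoint T y"
  by (simp add: inner_eq_Re_cinner cinner_cadjoint[OF contraction_bounded])

lemma contraction_cadjoint: "contraction (cadjoint T)"
  unfolding contraction_def
proof (intro conjI allI)
  show "cadjoint T \<in> bounded_ops UNIV UNIV"
    by (rule cadjoint_bounded[OF contraction_bounded])
  fix y
  have "norm (cadjoint T y) * norm (cadjoint T y) = T (cadjoint T y) \<bullet> y"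
    by (simp add: inner_cadjoint dot_square_norm power2_eq_square)
  also have "\<dots> \<le> norm (T (cadjoint T y)) * norm y"
    by (rule norm_cauchy_schwarz)
  also have "\<dots> \<le> norm (cadjoint T y) * norm y"
    by (intro mult_right_mono contraction_norm) auto
  finally show "norm (cadjoint T y) \<le> norm y"
    by (cases "cadjoint T y = 0") auto
qed

lemma cadjoint_cadjoint: "cadjoint (cadjoint T) = T"
proof
  fix y
  have "cinner (cadjoint T u) w = cinner u (T w)" for u w
  proof -
    have "cinner (cadjoint T u) w = cnj (cinner w (cadjoint T u))"
      by (rule cinner_commute)
    also have "\<dots> = cnj (cinner (T w) u)"
      by (simp only: cinner_cadjoint[OF contraction_bounded])
    also have "\<dots> = cinner u (T w)"
      by (rule cinner_commute[symmetric])
    finally show ?thesis .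
  qed
  then show "cadjoint (cadjoint T) y = T y"
    by (rule adjoint_on_eq[OF subspace_UNIV contraction_bounded]) (rule UNIV_I)
qed

lemma defect_op_adj_eq: "defect_op_adj T = defect_op (cadjoint T)"
  by (simp add: defect_op_adj_def defect_op_def cadjoint_cadjoint)

lemma
  shows defect_op_positive: "positive_op (defect_op T)"
    and defect_op_square: "defect_op T (defect_op T x) = x - cadjoint T (T x)"
proof -
  have B: "(\<lambda>x. cadjoint T (T x)) \<in> bounded_ops UNIV UNIV"
    by (rule bounded_ops_comp[OF cadjoint_bounded[OF contraction_bounded] contraction_bounded])
  have contr: "norm (cadjoint T (T x)) \<le> norm x" for x
  proof -
    have "norm (cadjoint T (T x)) \<le> norm (T x)"
      using contraction_cadjoint by (simp add: contraction_def)
    also have "\<dots> \<le> norm x"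
      by (rule contraction_norm)
    finally show ?thesis .
  qed
  have sym: "cadjoint T (T x) \<bullet> y = x \<bullet> cadjoint T (T y)" for x y
    by (metis inner_cadjoint inner_commute)
  show "positive_op (defect_op T)"
    unfolding defect_op_def by (rule positive_sqrt_op[OF B contr sym])
  show "defect_op T (defect_op T x) = x - cadjoint T (T x)"
    unfolding defect_op_def by (rule sqrt_op_square[OF B contr sym])
qed

lemma defect_op_bounded: "defect_op T \<in> bounded_ops UNIV UNIV"
  and defect_op_symmetric: "defect_op T x \<bullet> y = x \<bullet> defect_op T y"
  using defect_op_positive by (auto simp: positive_op_iff)

lemma norm_defect_op: "(norm (defect_op T x))\<^sup>2 = (norm x)\<^sup>2 - (norm (T x))\<^sup>2"
  by (simp add: power2_norm_eq_inner defect_op_symmetric defect_op_square inner_diff_right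
      inner_cadjoint)

lemma defect_op_eq_0_iff: "defect_op T x = 0 \<longleftrightarrow> cadjoint T (T x) = x"
proof
  assume "defect_op T x = 0"
  then have "defect_op T (defect_op T x) = 0"
    using bounded_ops_zero[OF defect_op_bounded] by simp
  then show "cadjoint T (T x) = x"
    by (simp add: defect_op_square)
next
  assume "cadjoint T (T x) = x"
  then have "defect_op T (defect_op T x) = 0"
    by (simp add: defect_op_square)
  then have "defect_op T x \<bullet> defect_op T x = 0"
    by (simp add: defect_op_symmetric)
  then show "defect_op T x = 0"
    by simp
qed

lemma defect_op_eq_0_of_norm_eq:
  assumes "norm (T x) = norm x"
  shows "defect_op T x = 0"
  using norm_defect_op[of x] assms by simp

lemma mem_defect_space_iff:
  "x \<in> defect_space T \<longleftrightarrow> (\<forall>w. defect_op T w = 0 \<longrightarrow> x \<bullet> w = 0)"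
  unfolding defect_space_def
  by (rule closure_range_symmetric)
    (use defect_op_bounded defect_op_symmetric in \<open>auto simp: bounded_ops_UNIV_iff\<close>)

end

text \<open>
  If \<open>w\<close> is in the kernel of the defect operator of the adjoint \<open>V\<close>, that is \<open>T (V w) = w\<close>, then
  \<open>V (T (V w)) = V w\<close> puts \<open>V w\<close> in the kernel of the defect operator of \<open>T\<close>. Hence
  \<open>\<langle>T x, w\<rangle> = \<langle>x, V w\<rangle> = 0\<close> for \<open>x\<close> in the defect space of \<open>T\<close>.
\<close>

lemma contraction_maps_defect_space:
  fixes T :: "'a::chilbert_space \<Rightarrow> 'a"
  assumes T: "contraction T" and x: "x \<in> defect_space T"
  shows "T x \<in> defect_space_adj T"
proof -
  let ?V = "cadjoint T"
  note V = contraction_cadjoint[OF T]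
  have "T x \<bullet> w = 0" if "defect_op ?V w = 0" for w
  proof -
    have "T (?V w) = w"
      using that by (simp add: defect_op_eq_0_iff[OF V] cadjoint_cadjoint[OF T])
    then have "defect_op T (?V w) = 0"
      by (simp add: defect_op_eq_0_iff[OF T])
    then show ?thesis
      using x by (simp add: mem_defect_space_iff[OF T] inner_cadjoint[OF T])
  qed
  then have "T x \<in> defect_space ?V"
    by (simp add: mem_defect_space_iff[OF V])
  then show ?thesis
    by (simp add: defect_space_def defect_space_adj_def defect_op_adj_eq[OF T])
qed

text \<open>
  The equation \<open>h = u + z V h\<close> is a fixed point problem for a strict contraction. Solving it inside
  an invariant closed subspace shows that the resolvent preserves the subspace.
\<close>

lemma inv_one_minus_scaleC_contraction:
  fixes V :: "'a::chilbert_space \<Rightarrow> 'a"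
  assumes V: "contraction V" and z: "cmod z < 1"
    and M: "closed_csubspace M" "\<And>h. h \<in> M \<Longrightarrow> V h \<in> M" and u: "u \<in> M"
  defines "h \<equiv> inv (\<lambda>h. h - z *\<^sub>C V h) u"
  shows "h \<in> M" and "h - z *\<^sub>C V h = u"
proof -
  interpret V: bounded_linear V
    using contraction_bounded[OF V] by (simp add: bounded_ops_UNIV_iff)
  interpret z: bounded_linear "\<lambda>x. z *\<^sub>C (x :: 'a)"
    by (rule bounded_linear_scaleC)
  have lip: "norm (z *\<^sub>C V a - z *\<^sub>C V b) \<le> cmod z * norm (a - b)" for a b
    using contraction_norm[OF V, of "a - b"]
    by (simp add: z.diff[symmetric] V.diff[symmetric] norm_scaleC mult_left_mono)
  have inj: "inj (\<lambda>h. h - z *\<^sub>C V h)"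
  proof (rule injI)
    fix a b assume "a - z *\<^sub>C V a = b - z *\<^sub>C V b"
    then have "a - b = z *\<^sub>C V a - z *\<^sub>C V b"
      by (simp add: algebra_simps)
    then have "norm (a - b) \<le> cmod z * norm (a - b)"
      using lip[of a b] by simp
    then have "(1 - cmod z) * norm (a - b) \<le> 0"
      by (simp add: algebra_simps)
    then show "a = b"
      using z by (simp add: mult_le_0_iff)
  qed
  have sub: "subspace M" "closed M" "\<And>c x. x \<in> M \<Longrightarrow> c *\<^sub>C x \<in> M"
    using M by (auto simp: closed_csubspace_def)
  have "\<exists>!h. h \<in> M \<and> u + z *\<^sub>C V h = h"
  proof (rule Banach_fix)
    show "complete M"
      using sub by (simp add: complete_eq_closed)
    show "M \<noteq> {}"
      using u by auto
    show "(\<lambda>h. u + z *\<^sub>C V h) ` M \<subseteq> M"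
      using sub u M(2) by (auto intro: subspace_add)
    show "0 \<le> cmod z" "cmod z < 1"
      using z by auto
    show "dist (u + z *\<^sub>C V a) (u + z *\<^sub>C V b) \<le> cmod z * dist a b" for a b
      using lip by (simp add: dist_norm)
  qed
  then obtain g where g: "g \<in> M" "u + z *\<^sub>C V g = g"
    by blast
  then have eq: "g - z *\<^sub>C V g = u"
    by (metis add_diff_cancel_right')
  have "h = g"
    unfolding h_def by (rule inv_f_eq[OF inj eq])
  with g eq show "h \<in> M" "h - z *\<^sub>C V h = u"
    by simp_all
qed

lemma geometric_expansion:
  assumes V: "V \<in> bounded_ops UNIV UNIV" and h: "h - z *\<^sub>C V h = u"
  shows "h = (\<Sum>k<n. z ^ k *\<^sub>C (V ^^ k) u) + z ^ n *\<^sub>C (V ^^ n) h"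
proof (induction n)
  case (Suc n)
  have "h = u + z *\<^sub>C V h"
    using h by (simp add: algebra_simps)
  then have "(V ^^ n) h = (V ^^ n) (u + z *\<^sub>C V h)"
    by simp
  also have "\<dots> = (V ^^ n) u + z *\<^sub>C (V ^^ n) (V h)"
    using bounded_ops_funpow[OF V, of n] by (simp add: bounded_ops_def)
  also have "(V ^^ n) (V h) = (V ^^ Suc n) h"
    by (simp add: funpow_swap1)
  finally have eq: "(V ^^ n) h = (V ^^ n) u + z *\<^sub>C (V ^^ Suc n) h" .
  have "z ^ n *\<^sub>C (V ^^ n) h = z ^ n *\<^sub>C (V ^^ n) u + z ^ Suc n *\<^sub>C (V ^^ Suc n) h"
    by (subst eq) (simp only: scaleC_add_right scaleC_scaleC power_Suc2)
  with Suc.IH show ?case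
    by (simp add: add.assoc)
qed (simp add: scaleC_one)

section \<open>Contractions in upper triangular form\<close>

context
  fixes H1 H0 Hm :: "'a::chilbert_space set" and S N C T :: "'a \<Rightarrow> 'a" and n :: nat
  assumes dec: "orthogonal_decomposition H1 H0 Hm"
    and S: "isometry_on H1 S" and N: "nilpotent_on H0 N n" and C: "coisometry_on Hm C"
    and T: "contraction T" and form: "upper_triangular_form H1 H0 Hm S N C T"
begin

lemma zero_mem: "0 \<in> H1" "0 \<in> H0" "0 \<in> Hm"
  using dec by (auto simp: orthogonal_decomposition_def closed_csubspace_def subspace_0)

lemma orthogonal:
  "x \<in> H1 \<Longrightarrow> y \<in> H0 \<Longrightarrow> x \<bullet> y = 0"
  "x \<in> H1 \<Longrightarrow> w \<in> Hm \<Longrightarrow> x \<bullet> w = 0"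
  "y \<in> H0 \<Longrightarrow> w \<in> Hm \<Longrightarrow> y \<bullet> w = 0"
  using dec by (auto simp: orthogonal_decomposition_def inner_eq_Re_cinner)

lemma mem_Hm:
  assumes "\<And>x. x \<in> H1 \<Longrightarrow> x \<bullet> h = 0" "\<And>y. y \<in> H0 \<Longrightarrow> y \<bullet> h = 0"
  shows "h \<in> Hm"
proof -
  obtain x y w where h: "x \<in> H1" "y \<in> H0" "w \<in> Hm" "h = x + y + w"
    using dec unfolding orthogonal_decomposition_def by blast
  have "x \<bullet> x = 0"
    using assms(1)[OF h(1)] h orthogonal by (simp add: inner_add_right)
  moreover have "y \<bullet> y = 0"
    using assms(2)[OF h(2)] h orthogonal by (simp add: inner_add_right inner_commute[of y x])
  ultimately show ?thesis
    using h by simp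
qed

lemma T_on_H1: "x \<in> H1 \<Longrightarrow> T x = S x"
  and T_on_H0: "y \<in> H0 \<Longrightarrow> \<exists>x\<in>H1. T y = N y + x"
  and T_on_Hm: "w \<in> Hm \<Longrightarrow> \<exists>x\<in>H1. \<exists>y\<in>H0. T w = x + y + C w"
proof -
  obtain A B D where A: "A \<in> bounded_ops H0 H1" and B: "B \<in> bounded_ops Hm H1"
    and D: "D \<in> bounded_ops Hm H0"
    and eq: "\<And>x y w. x \<in> H1 \<Longrightarrow> y \<in> H0 \<Longrightarrow> w \<in> Hm \<Longrightarrow>
      T (x + y + w) = (S x + A y + B w) + (N y + D w) + C w"
    using form unfolding upper_triangular_form_def by blast
  have bd: "S \<in> bounded_ops H1 H1" "N \<in> bounded_ops H0 H0" "C \<in> bounded_ops Hm Hm"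
    using S N C by (auto simp: isometry_on_def nilpotent_on_def coisometry_on_def)
  note zero [simp] = zero_mem bounded_ops_zero[OF bd(1)] bounded_ops_zero[OF bd(2)]
    bounded_ops_zero[OF bd(3)] bounded_ops_zero[OF A] bounded_ops_zero[OF B]
    bounded_ops_zero[OF D]
  show "T x = S x" if "x \<in> H1"
    using eq[of x 0 0] that by simp
  show "\<exists>x\<in>H1. T y = N y + x" if "y \<in> H0"
    using eq[of 0 y 0] that A by (auto simp: bounded_ops_def add.commute intro!: bexI[of _ "A y"])
  show "\<exists>x\<in>H1. \<exists>y\<in>H0. T w = x + y + C w" if "w \<in> Hm"
  proof -
    have "T w = B w + D w + C w"
      using eq[of 0 0 w] that by simp
    moreover have "B w \<in> H1" "D w \<in> H0"
      using that B D by (auto simp: bounded_ops_def)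
    ultimately show ?thesis
      by blast
  qed
qed

lemma T_maps_H1: "x \<in> H1 \<Longrightarrow> T x \<in> H1"
  using T_on_H1 S by (auto simp: isometry_on_def bounded_ops_def)

lemma N_maps_H0: "y \<in> H0 \<Longrightarrow> (N ^^ k) y \<in> H0"
  by (induction k) (use N in \<open>auto simp: nilpotent_on_def bounded_ops_def\<close>)

text \<open>
  Modulo \<open>H1\<close>, which \<open>T\<close> leaves invariant, \<open>T\<close> acts on \<open>H0\<close> as \<open>N\<close>.
\<close>

lemma funpow_T_on_H0:
  assumes "y \<in> H0"
  shows "\<exists>x\<in>H1. (T ^^ k) y = (N ^^ k) y + x"
proof (induction k)
  case 0
  show ?case
    using zero_mem by (intro bexI[of _ 0]) auto
next
  case (Suc k)
  then obtain x where x: "x \<in> H1" "(T ^^ k) y = (N ^^ k) y + x" by blast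
  obtain x' where x': "x' \<in> H1" "T ((N ^^ k) y) = N ((N ^^ k) y) + x'"
    using T_on_H0 N_maps_H0[OF assms] by blast
  have "T ((N ^^ k) y + x) = N ((N ^^ k) y) + (x' + T x)"
    using contraction_bounded[OF T] x' by (simp add: bounded_ops_def)
  moreover have "x' + T x \<in> H1"
    using dec x x' T_maps_H1
    by (auto simp: orthogonal_decomposition_def closed_csubspace_def intro: subspace_add)
  ultimately show ?case
    using x by auto
qed

lemma funpow_T_H0_subset_H1:
  assumes "y \<in> H0"
  shows "(T ^^ n) y \<in> H1"
  using funpow_T_on_H0[OF assms, of n] N assms by (auto simp: nilpotent_on_def)

lemma cadjoint_maps_H1_perp: "h \<in> orthogonal_comp H1 \<Longrightarrow> cadjoint T h \<in> orthogonal_comp H1"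
  using T_maps_H1 by (auto simp: mem_orthogonal_comp inner_cadjoint[OF T, symmetric])

text \<open>
  By duality with the fact that \<open>T\<^sup>n\<close> maps both \<open>H1\<close> and \<open>H0\<close> into \<open>H1\<close>.
\<close>

lemma funpow_cadjoint_H1_perp:
  assumes h: "h \<in> orthogonal_comp H1"
  shows "(cadjoint T ^^ n) h \<in> Hm"
proof -
  have maps: "(cadjoint T ^^ k) h \<in> orthogonal_comp H1" for k
    by (induction k) (use h cadjoint_maps_H1_perp in auto)
  have adj: "y \<bullet> (cadjoint T ^^ k) h = (T ^^ k) y \<bullet> h" for k y
    by (induction k arbitrary: y) (simp_all add: inner_cadjoint[OF T, symmetric] funpow_swap1[of T])
  show ?thesis
    by (rule mem_Hm) (use maps[of n] funpow_T_H0_subset_H1 h in \<open>auto simp: adj mem_orthogonal_comp\<close>)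
qed

lemma cadjoint_maps_Hm:
  assumes w: "w \<in> Hm"
  shows "cadjoint T w \<in> Hm"
proof (rule mem_Hm)
  show "x \<bullet> cadjoint T w = 0" if "x \<in> H1" for x
    using T_maps_H1[OF that] w orthogonal by (simp add: inner_cadjoint[OF T, symmetric])
  show "y \<bullet> cadjoint T w = 0" if y: "y \<in> H0" for y
    using T_on_H0[OF y] N_maps_H0[OF y, of 1] w orthogonal
    by (auto simp: inner_cadjoint[OF T, symmetric] inner_add_left)
qed

text \<open>
  The subspace \<open>Hm\<close> is invariant under the adjoint of \<open>T\<close>, which restricts there to the adjoint of
  the compression \<open>C\<close> of \<open>T\<close>.
\<close>

lemma norm_cadjoint_Hm:
  assumes w: "w \<in> Hm"
  shows "norm (cadjoint T w) = norm w"
proof -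
  have "adjoint_on Hm Hm C w = cadjoint T w"
  proof (rule adjoint_on_eq[OF _ _ _ w])
    show "subspace Hm"
      using dec by (simp add: orthogonal_decomposition_def closed_csubspace_def)
    show "cadjoint T \<in> bounded_ops Hm Hm"
      by (rule bounded_ops_UNIV_restrict[OF cadjoint_bounded[OF contraction_bounded[OF T]]])
        (rule cadjoint_maps_Hm)
    show "cinner (C u) v = cinner u (cadjoint T v)" if u: "u \<in> Hm" and v: "v \<in> Hm" for u v
    proof -
      obtain x y where xy: "x \<in> H1" "y \<in> H0" "T u = x + y + C u"
        using T_on_Hm[OF u] by blast
      have "cinner (C u) v = cinner (T u) v"
        using xy v dec by (simp add: orthogonal_decomposition_def cinner_add_left)
      then show ?thesis
        by (simp add: cinner_cadjoint[OF contraction_bounded[OF T]])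
    qed
  qed
  moreover have "norm (adjoint_on Hm Hm C w) = norm w"
    using C w by (simp add: coisometry_on_def isometry_on_def)
  ultimately show ?thesis
    by simp
qed

lemma defect_op_H1_perp: "defect_op T x \<in> orthogonal_comp H1"
proof -
  have "defect_op T u = 0" if "u \<in> H1" for u
    using that T_on_H1[OF that] S
    by (intro defect_op_eq_0_of_norm_eq[OF T]) (simp add: isometry_on_def)
  then show ?thesis
    by (simp add: mem_orthogonal_comp defect_op_symmetric[OF T, symmetric])
qed

lemma defect_op_adj_Hm: "w \<in> Hm \<Longrightarrow> defect_op_adj T w = 0"
  unfolding defect_op_adj_eq[OF T]
  by (rule defect_op_eq_0_of_norm_eq[OF contraction_cadjoint[OF T] norm_cadjoint_Hm])

text \<open>
  Under the defect operator of the adjoint the Neumann series breaks off: after \<open>n\<close> steps of the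
  expansion the remainder is a multiple of a vector in \<open>Hm\<close>, where that operator vanishes.
\<close>

lemma defect_op_adj_resolvent:
  assumes z: "cmod z < 1" and u: "u \<in> orthogonal_comp H1"
  shows "defect_op_adj T (inv (\<lambda>h. h - z *\<^sub>C cadjoint T h) u)
    = (\<Sum>k<n. z ^ k *\<^sub>C defect_op_adj T ((cadjoint T ^^ k) u))"
proof -
  let ?V = "cadjoint T" and ?E = "defect_op_adj T"
  define h where "h = inv (\<lambda>h. h - z *\<^sub>C ?V h) u"
  note V = contraction_cadjoint[OF T]
  have "closed_csubspace (orthogonal_comp H1)"
    using dec by (intro closed_csubspace_orthogonal_comp)
      (auto simp: orthogonal_decomposition_def closed_csubspace_def)
  from inv_one_minus_scaleC_contraction[OF V z this cadjoint_maps_H1_perp u]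
  have h: "h \<in> orthogonal_comp H1" "h - z *\<^sub>C ?V h = u"
    unfolding h_def by auto
  have E: "?E \<in> bounded_ops UNIV UNIV"
    unfolding defect_op_adj_eq[OF T] by (rule defect_op_bounded[OF V])
  then interpret E: bounded_linear ?E
    by (simp add: bounded_ops_UNIV_iff)
  have scale: "?E (c *\<^sub>C x) = c *\<^sub>C ?E x" for c x
    using E by (simp add: bounded_ops_def)
  have "?E h = ?E ((\<Sum>k<n. z ^ k *\<^sub>C (?V ^^ k) u) + z ^ n *\<^sub>C (?V ^^ n) h)"
    using geometric_expansion[OF contraction_bounded[OF V] h(2), of n] by simp
  also have "\<dots> = (\<Sum>k<n. z ^ k *\<^sub>C ?E ((?V ^^ k) u)) + z ^ n *\<^sub>C ?E ((?V ^^ n) h)"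
    by (simp only: E.add E.sum scale)
  also have "?E ((?V ^^ n) h) = 0"
    by (rule defect_op_adj_Hm[OF funpow_cadjoint_H1_perp[OF h(1)]])
  finally show ?thesis
    unfolding h_def by (simp add: linear_0[OF bounded_linear.linear[OF bounded_linear_scaleC]])
qed

end

theorem proposition3p1:
  fixes H1 H0 Hm :: "'a::chilbert_space set"
    and S N C T :: "'a \<Rightarrow> 'a"
    and n :: nat
  assumes "separable_space (euclidean :: 'a topology)"
    and "orthogonal_decomposition H1 H0 Hm"
    and "isometry_on H1 S"
    and "nilpotent_on H0 N n"
    and "coisometry_on Hm C"
    and "contraction T"
    and "upper_triangular_form H1 H0 Hm S N C T"
  shows "op_polynomial_le (defect_space T) (defect_space_adj T) n (characteristic_function T)"
proof -
  note tri = assms(2-7)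
  note T = assms(6)
  let ?V = "cadjoint T" and ?D = "defect_op T" and ?E = "defect_op_adj T"
  define A where "A k = (case k of 0 \<Rightarrow> (\<lambda>x. - T x) | Suc j \<Rightarrow> (\<lambda>x. ?E ((?V ^^ j) (?D x))))" for k
  have E: "?E \<in> bounded_ops UNIV UNIV"
    unfolding defect_op_adj_eq[OF T] by (rule defect_op_bounded[OF contraction_cadjoint[OF T]])
  have "A k \<in> bounded_ops (defect_space T) (defect_space_adj T)" for k
  proof (cases k)
    case 0
    have "subspace (range ?E)"
      using E by (simp add: bounded_ops_UNIV_iff bounded_linear.linear linear_subspace_image)
    then have "subspace (defect_space_adj T)"
      unfolding defect_space_adj_def by (rule subspace_closure)
    moreover have "(\<lambda>x. - T x) \<in> bounded_ops UNIV UNIV"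
      using contraction_bounded[OF T]
      by (auto simp: bounded_ops_UNIV_iff bounded_linear_minus
          linear_neg[OF bounded_linear.linear[OF bounded_linear_scaleC]])
    ultimately show ?thesis
      using contraction_maps_defect_space[OF T]
      by (auto simp: 0 A_def subspace_neg intro: bounded_ops_UNIV_restrict)
  next
    case (Suc j)
    have "A k \<in> bounded_ops UNIV UNIV"
      unfolding A_def Suc nat.case
      by (rule bounded_ops_comp[OF E bounded_ops_comp[OF
              bounded_ops_funpow[OF cadjoint_bounded[OF contraction_bounded[OF T]]]
              defect_op_bounded[OF T]]])
    moreover have "A k x \<in> defect_space_adj T" for x
      using closure_subset[of "range ?E"] by (auto simp: A_def Suc defect_space_adj_def)
    ultimately show ?thesis
      by (rule bounded_ops_UNIV_restrict)
  qed
  moreover have "characteristic_function T z x = (\<Sum>k\<le>n. z ^ k *\<^sub>C A k x)"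
    if z: "z \<in> ball 0 1" and x: "x \<in> defect_space T" for z x
  proof -
    have "cmod z < 1"
      using z by simp
    note expand = defect_op_adj_resolvent[OF tri this defect_op_H1_perp[OF tri]]
    have "characteristic_function T z x = - T x + z *\<^sub>C (\<Sum>k<n. z ^ k *\<^sub>C ?E ((?V ^^ k) (?D x)))"
      using x by (simp add: characteristic_function_def expand)
    also have "\<dots> = (\<Sum>k\<le>n. z ^ k *\<^sub>C A k x)"
      by (simp add: sum.atMost_shift A_def scaleC_one scaleC_scaleC
          linear_sum[OF bounded_linear.linear[OF bounded_linear_scaleC]])
    finally show ?thesis .
  qed
  ultimately show ?thesis
    unfolding op_polynomial_le_def by blast
qed

end
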